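(* Let $p$ be a prime, let $d\ge 2$, and let $G=G_{p,d}=C_p\wr X$ be the restricted wreath product, where $C_p=\langle a\rangle$ has order $p$ and $X$ is a free abelian group of finite rank $d$. Let $A$ be the normal closure of $\langle a\rangle$ in $G$, so that $G=AX$. Let $H$ be a subgroup of finite index in $G$ and let $f:H\to G$ be a homomorphism. Suppose that $H$ projects onto $X$ modulo $A$ (that is, $AH=G$). Then $f$ is not simple.
   Context: The restricted wreath product $C_p\wr X$ is the semidirect product $A\rtimes X$, where $A=\bigoplus_{w\in X}\langle a^w\rangle$ (with $a^w=w^{-1}aw$) is the direct sum of copies of $C_p$ indexed by $X$, and $X$ acts by conjugation, permuting the copies regularly. For a subgroup $H$ of finite index in a group $G$, a homomorphism $f:H\to G$ is called a virtual endomorphism of $G$. A subgroup $K\le H$ is $f$-invariant if $K^f\le K$ (maps are written on the right as exponents). The $f$-core of $H$ is the largest subgroup of $H$ that is normal in $G$ and $f$-invariant. The homomorphism $f$ is simple if the $f$-core is trivial, i.e. the only subgroup $K\le H$ which is normal in $G$ and $f$-invariant is $K=1$. *)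

theory Defs
  imports "HOL-Algebra.Free_Abelian_Groups" "HOL-Computational_Algebra.Primes"
begin

text \<open>
  The base group of the restricted wreath product of \<open>C\<close> by \<open>X\<close> is the direct sum of copies of
  \<open>C\<close> indexed by \<open>carrier X\<close>; a pair \<open>(u, x)\<close> stands for the product \<open>u x\<close>.  The coordinate at
  \<open>w\<close> belongs to the copy \<open>C\<^sup>w\<close>, where \<open>a\<^sup>w = w\<^sup>-\<^sup>1 a w\<close>.  Since
  \<open>x a\<^sup>w x\<^sup>-\<^sup>1 = a\<^bsup>w x\<^sup>-\<^sup>1\<^esup>\<close>, the coordinate of \<open>x v x\<^sup>-\<^sup>1\<close> at \<open>w\<close> is \<open>v (w x)\<close>, and
  \<open>(u x) (v y) = (u \<sqdot> x v x\<^sup>-\<^sup>1) (x y)\<close> gives the multiplication.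
\<close>

definition restricted_wreath ::
    "('c, 'm) monoid_scheme \<Rightarrow> ('x, 'n) monoid_scheme \<Rightarrow> (('x \<Rightarrow> 'c) \<times> 'x) monoid" where
  "restricted_wreath C X =
    \<lparr>carrier = carrier (sum_group (carrier X) (\<lambda>_. C)) \<times> carrier X,
     monoid.mult = (\<lambda>(u, x) (v, y).
       (u \<otimes>\<^bsub>sum_group (carrier X) (\<lambda>_. C)\<^esub> (\<lambda>w\<in>carrier X. v (w \<otimes>\<^bsub>X\<^esub> x)), x \<otimes>\<^bsub>X\<^esub> y)),
     one = (\<one>\<^bsub>sum_group (carrier X) (\<lambda>_. C)\<^esub>, \<one>\<^bsub>X\<^esub>)\<rparr>"

definition single ::
    "('c, 'm) monoid_scheme \<Rightarrow> ('x, 'n) monoid_scheme \<Rightarrow> 'x \<Rightarrow> 'c \<Rightarrow> 'x \<Rightarrow> 'c" where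
  "single C X w c = (\<lambda>v\<in>carrier X. if v = w then c else \<one>\<^bsub>C\<^esub>)"

definition wreath_base ::
    "('c, 'm) monoid_scheme \<Rightarrow> ('x, 'n) monoid_scheme \<Rightarrow> 'c \<Rightarrow> ('x \<Rightarrow> 'c) \<times> 'x" where
  "wreath_base C X c = (single C X \<one>\<^bsub>X\<^esub> c, \<one>\<^bsub>X\<^esub>)"

definition wreath_top ::
    "('c, 'm) monoid_scheme \<Rightarrow> ('x, 'n) monoid_scheme \<Rightarrow> 'x \<Rightarrow> ('x \<Rightarrow> 'c) \<times> 'x" where
  "wreath_top C X x = (\<one>\<^bsub>sum_group (carrier X) (\<lambda>_. C)\<^esub>, x)"

definition normal_closure :: "('g, 'm) monoid_scheme \<Rightarrow> 'g set \<Rightarrow> 'g set" where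
  "normal_closure G S = \<Inter>{N. N \<lhd> G \<and> S \<subseteq> N}"

definition virtual_endomorphism ::
    "('g, 'm) monoid_scheme \<Rightarrow> 'g set \<Rightarrow> ('g \<Rightarrow> 'g) \<Rightarrow> bool" where
  "virtual_endomorphism G H f \<longleftrightarrow>
    subgroup H G \<and> finite (rcosets\<^bsub>G\<^esub> H) \<and> f \<in> hom (G\<lparr>carrier := H\<rparr>) G"

definition simple_virtual_endomorphism ::
    "('g, 'm) monoid_scheme \<Rightarrow> 'g set \<Rightarrow> ('g \<Rightarrow> 'g) \<Rightarrow> bool" where
  "simple_virtual_endomorphism G H f \<longleftrightarrow>
    virtual_endomorphism G H f \<and>
    (\<forall>K. K \<subseteq> H \<and> K \<lhd> G \<and> f ` K \<subseteq> K \<longrightarrow> K = {\<one>\<^bsub>G\<^esub>})"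

lemma restricted_wreath_shift_closed:
  assumes "group C" "group X" "v \<in> carrier (sum_group (carrier X) (\<lambda>_. C))" "x \<in> carrier X"
  shows "(\<lambda>w\<in>carrier X. v (w \<otimes>\<^bsub>X\<^esub> x)) \<in> carrier (sum_group (carrier X) (\<lambda>_. C))"
proof -
  interpret C: group C by fact
  interpret X: group X by fact
  have v: "v \<in> carrier X \<rightarrow>\<^sub>E carrier C" "finite {w \<in> carrier X. v w \<noteq> \<one>\<^bsub>C\<^esub>}"
    using assms(3) by (auto simp: carrier_sum_group assms(1))
  have "{w \<in> carrier X. v (w \<otimes>\<^bsub>X\<^esub> x) \<noteq> \<one>\<^bsub>C\<^esub>}
      \<subseteq> (\<lambda>w. w \<otimes>\<^bsub>X\<^esub> inv\<^bsub>X\<^esub> x) ` {w \<in> carrier X. v w \<noteq> \<one>\<^bsub>C\<^esub>}"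
  proof
    fix w assume "w \<in> {w \<in> carrier X. v (w \<otimes>\<^bsub>X\<^esub> x) \<noteq> \<one>\<^bsub>C\<^esub>}"
    then show "w \<in> (\<lambda>w. w \<otimes>\<^bsub>X\<^esub> inv\<^bsub>X\<^esub> x) ` {w \<in> carrier X. v w \<noteq> \<one>\<^bsub>C\<^esub>}"
      using assms(4) by (intro image_eqI[of _ _ "w \<otimes>\<^bsub>X\<^esub> x"]) (auto simp: X.m_assoc)
  qed
  then have "finite {w \<in> carrier X. v (w \<otimes>\<^bsub>X\<^esub> x) \<noteq> \<one>\<^bsub>C\<^esub>}"
    using v(2) finite_surj by blast
  then show ?thesis
    using v(1) assms(4) by (auto simp: carrier_sum_group assms(1) cong: conj_cong)
qed

lemma group_restricted_wreath:
  assumes "group C" "group X"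
  shows "group (restricted_wreath C X)"
proof -
  interpret C: group C by fact
  interpret X: group X by fact
  let ?B = "sum_group (carrier X) (\<lambda>_. C)"
  interpret B: group ?B using assms by simp
  have shift: "(\<lambda>w\<in>carrier X. v (w \<otimes>\<^bsub>X\<^esub> x)) \<in> carrier ?B"
    if "v \<in> carrier ?B" "x \<in> carrier X" for v x
    using restricted_wreath_shift_closed[OF assms that] .
  have val: "v w \<in> carrier C" if "v \<in> carrier ?B" "w \<in> carrier X" for v w
    using that by (auto simp: carrier_sum_group assms(1))
  have ext: "v \<in> extensional (carrier X)" if "v \<in> carrier ?B" for v
    using that by (auto simp: carrier_sum_group assms(1) PiE_iff)
  show ?thesis
  proof (rule groupI)
    fix g h assume "g \<in> carrier (restricted_wreath C X)" "h \<in> carrier (restricted_wreath C X)"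
    then show "g \<otimes>\<^bsub>restricted_wreath C X\<^esub> h \<in> carrier (restricted_wreath C X)"
      using B.m_closed shift
      by (auto simp: restricted_wreath_def simp del: mult_sum_group)
  next
    show "\<one>\<^bsub>restricted_wreath C X\<^esub> \<in> carrier (restricted_wreath C X)"
      using B.one_closed by (simp add: restricted_wreath_def)
  next
    fix g h k assume "g \<in> carrier (restricted_wreath C X)" "h \<in> carrier (restricted_wreath C X)"
      "k \<in> carrier (restricted_wreath C X)"
    then show "g \<otimes>\<^bsub>restricted_wreath C X\<^esub> h \<otimes>\<^bsub>restricted_wreath C X\<^esub> k
        = g \<otimes>\<^bsub>restricted_wreath C X\<^esub> (h \<otimes>\<^bsub>restricted_wreath C X\<^esub> k)"
      by (auto simp: restricted_wreath_def val X.m_assoc C.m_assoc intro!: restrict_ext)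
  next
    fix g assume "g \<in> carrier (restricted_wreath C X)"
    then show "\<one>\<^bsub>restricted_wreath C X\<^esub> \<otimes>\<^bsub>restricted_wreath C X\<^esub> g = g"
      by (auto simp: restricted_wreath_def val intro!: extensionalityI[OF restrict_extensional ext])
  next
    fix g assume "g \<in> carrier (restricted_wreath C X)"
    then obtain u x where g: "g = (u, x)" "u \<in> carrier ?B" "x \<in> carrier X"
      by (auto simp: restricted_wreath_def)
    let ?u = "(\<lambda>w\<in>carrier X. (inv\<^bsub>?B\<^esub> u) (w \<otimes>\<^bsub>X\<^esub> inv\<^bsub>X\<^esub> x))"
    have "?u \<in> carrier ?B" using shift[OF B.inv_closed[OF g(2)]] g(3) by simp
    then have "(?u, inv\<^bsub>X\<^esub> x) \<in> carrier (restricted_wreath C X)"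
      using g by (simp add: restricted_wreath_def)
    moreover have "(?u, inv\<^bsub>X\<^esub> x) \<otimes>\<^bsub>restricted_wreath C X\<^esub> g = \<one>\<^bsub>restricted_wreath C X\<^esub>"
      using g by (auto simp: restricted_wreath_def inv_sum_group assms(1) val intro!: restrict_ext)
    ultimately show "\<exists>h\<in>carrier (restricted_wreath C X).
        h \<otimes>\<^bsub>restricted_wreath C X\<^esub> g = \<one>\<^bsub>restricted_wreath C X\<^esub>"
      by blast
  qed
qed

text \<open>Conjugation convention: the coordinate at \<open>w\<close> of the base group is the conjugate of \<open>C\<close>
  by \<open>w\<close>.\<close>

lemma wreath_base_conj:
  assumes "group C" "group X" "c \<in> carrier C" "w \<in> carrier X"
  shows "inv\<^bsub>restricted_wreath C X\<^esub> (wreath_top C X w) \<otimes>\<^bsub>restricted_wreath C X\<^esub> wreath_base C X c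
      \<otimes>\<^bsub>restricted_wreath C X\<^esub> wreath_top C X w = (single C X w c, \<one>\<^bsub>X\<^esub>)"
proof -
  interpret C: group C by fact
  interpret X: group X by fact
  interpret W: group "restricted_wreath C X" using group_restricted_wreath assms by blast
  interpret B: group "sum_group (carrier X) (\<lambda>_. C)" using assms by simp
  have top: "wreath_top C X y \<in> carrier (restricted_wreath C X)" if "y \<in> carrier X" for y
    using that B.one_closed by (simp add: restricted_wreath_def wreath_top_def)
  have "inv\<^bsub>restricted_wreath C X\<^esub> (wreath_top C X w) = wreath_top C X (inv\<^bsub>X\<^esub> w)"
    using assms top
    by (intro W.inv_equality)
      (auto simp: restricted_wreath_def wreath_top_def intro!: restrict_ext)
  moreover have "v \<otimes>\<^bsub>X\<^esub> inv\<^bsub>X\<^esub> w = \<one>\<^bsub>X\<^esub> \<longleftrightarrow> v = w" if "v \<in> carrier X" for v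
    using that assms by (metis X.inv_closed X.inv_equality X.inv_inv X.r_inv)
  ultimately show ?thesis
    using assms
    by (auto simp: restricted_wreath_def wreath_top_def wreath_base_def single_def
        intro!: restrict_ext)
qed

end

theory Submission
  imports Defs "HOL-Algebra.Multiplicative_Group"
begin

text \<open>
  Write \<open>M\<close> for the base group, a module over the group ring of \<open>X\<close>, and let \<open>n\<close> be the index of
  \<open>H\<close> and \<open>m = n!\<close>.  By the pigeonhole principle \<open>(x\<^sup>m - 1) M \<subseteq> H\<close> for every \<open>x \<in> X\<close>.  Since \<open>X\<close> is
  torsion-free, \<open>f\<close> maps \<open>H \<inter> M\<close> into \<open>M\<close>, and it is semilinear there over the endomorphism \<open>\<theta>\<close>
  of \<open>X = H / (H \<inter> M)\<close> induced by \<open>f\<close>.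

  If \<open>\<theta> x = 1\<close> with \<open>x \<noteq> 1\<close>, then \<open>f\<close> kills the nonzero submodule \<open>(x - 1) (H \<inter> M)\<close>.  Otherwise
  \<open>\<theta>\<close> is injective, and the submodule \<open>K\<close> generated by all \<open>(x\<^sup>m - 1) M\<close> is \<open>f\<close>-invariant:
  choose \<open>x'\<close> independent of \<open>x\<close>, which is possible because the rank is at least 2, and apply \<open>f\<close> to
  \<open>(x'\<^sup>m - 1) (x\<^sup>m - 1) v = (x\<^sup>m - 1) (x'\<^sup>m - 1) v\<close>.  With \<open>y = \<theta> x\<close> and \<open>y' = \<theta> x'\<close> this shows that
  \<open>y\<^sup>m - 1\<close> divides \<open>(y'\<^sup>m - 1) f ((x\<^sup>m - 1) v)\<close>, hence also \<open>f ((x\<^sup>m - 1) v)\<close>, as \<open>y\<close> and \<open>y'\<close> are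
  independent.
\<close>

section \<open>Group-ring modules\<close>

text \<open>In a commutative group negative exponents can be moved across the equation, so this says
  that \<open>x\<close> and \<open>y\<close> freely generate a copy of \<open>Z^2\<close>. Natural
  exponents suit the rays \<open>w x^k\<close> followed below.\<close>

definition independent_powers :: "('x, 'n) monoid_scheme \<Rightarrow> 'x \<Rightarrow> 'x \<Rightarrow> bool" where
  "independent_powers X x y \<longleftrightarrow> (\<forall>(k :: nat) (j :: nat) (k' :: nat) (j' :: nat).
    x [^]\<^bsub>X\<^esub> k \<otimes>\<^bsub>X\<^esub> y [^]\<^bsub>X\<^esub> j = x [^]\<^bsub>X\<^esub> k' \<otimes>\<^bsub>X\<^esub> y [^]\<^bsub>X\<^esub> j' \<longrightarrow> k = k' \<and> j = j')"

lemma independent_powersD: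
  fixes k k' j j' :: nat
  assumes "independent_powers X x y"
    and "x [^]\<^bsub>X\<^esub> k \<otimes>\<^bsub>X\<^esub> y [^]\<^bsub>X\<^esub> j = x [^]\<^bsub>X\<^esub> k' \<otimes>\<^bsub>X\<^esub> y [^]\<^bsub>X\<^esub> j'"
  shows "k = k'" "j = j'"
  using assms unfolding independent_powers_def by blast+

lemma (in group) independent_inj_pow:
  assumes "independent_powers G x y" "x \<in> carrier G" "y \<in> carrier G"
  shows "inj (\<lambda>k :: nat. x [^] k)"
  using independent_powersD(1)[OF assms(1), of _ 0 _ 0] assms(2) by (auto intro!: injI)

lemma (in group) mult_inv_eq_one_iff:
  assumes "x \<in> carrier G" "y \<in> carrier G"
  shows "x \<otimes> inv y = \<one> \<longleftrightarrow> x = y"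
  using assms by (metis inv_closed inv_equality inv_inv r_inv)

locale abelian_wreath = C: comm_group C + X: comm_group X
  for C :: "('c, 'm) monoid_scheme" and X :: "('x, 'n) monoid_scheme"
begin

abbreviation M where "M \<equiv> sum_group (carrier X) (\<lambda>_. C)"

text \<open>The module operations \<open>x v\<close> and \<open>(x - 1) v\<close>; they are conjugation by, and commutation with,
  any element of the wreath product that lies over \<open>x\<close>.\<close>

definition shift :: "'x \<Rightarrow> ('x \<Rightarrow> 'c) \<Rightarrow> 'x \<Rightarrow> 'c" where
  "shift x v = (\<lambda>w\<in>carrier X. v (w \<otimes>\<^bsub>X\<^esub> x))"

definition diff :: "'x \<Rightarrow> ('x \<Rightarrow> 'c) \<Rightarrow> 'x \<Rightarrow> 'c" where
  "diff x v = shift x v \<otimes>\<^bsub>M\<^esub> inv\<^bsub>M\<^esub> v"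

lemma mem_M: "v \<in> carrier M \<longleftrightarrow>
    v \<in> carrier X \<rightarrow>\<^sub>E carrier C \<and> finite {w \<in> carrier X. v w \<noteq> \<one>\<^bsub>C\<^esub>}"
  by (simp add: carrier_sum_group)

lemma M_val: "v \<in> carrier M \<Longrightarrow> w \<in> carrier X \<Longrightarrow> v w \<in> carrier C"
  by (auto simp: mem_M)

lemma M_eqI: "u \<in> carrier M \<Longrightarrow> v \<in> carrier M \<Longrightarrow> (\<And>w. w \<in> carrier X \<Longrightarrow> u w = v w) \<Longrightarrow> u = v"
  unfolding mem_M by (elim conjE, rule PiE_ext)

sublocale M: comm_group M
proof (rule group.group_comm_groupI)
  show "group M" by simp
next
  fix u v assume "u \<in> carrier M" "v \<in> carrier M"
  then have "u w \<otimes>\<^bsub>C\<^esub> v w = v w \<otimes>\<^bsub>C\<^esub> u w" if "w \<in> carrier X" for w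
    using that by (intro C.m_comm M_val)
  then show "u \<otimes>\<^bsub>M\<^esub> v = v \<otimes>\<^bsub>M\<^esub> u"
    by (auto intro: restrict_ext)
qed

lemma shift_closed: "v \<in> carrier M \<Longrightarrow> x \<in> carrier X \<Longrightarrow> shift x v \<in> carrier M"
  unfolding shift_def by (rule restricted_wreath_shift_closed) (rule C.is_group X.is_group | assumption)+

lemma diff_closed: "v \<in> carrier M \<Longrightarrow> x \<in> carrier X \<Longrightarrow> diff x v \<in> carrier M"
  unfolding diff_def by (intro M.m_closed M.inv_closed shift_closed)

lemma diff_val:
  "v \<in> carrier M \<Longrightarrow> w \<in> carrier X \<Longrightarrow> diff x v w = v (w \<otimes>\<^bsub>X\<^esub> x) \<otimes>\<^bsub>C\<^esub> inv\<^bsub>C\<^esub> v w"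
  by (simp add: diff_def shift_def)

lemma shift_val: "w \<in> carrier X \<Longrightarrow> shift x v w = v (w \<otimes>\<^bsub>X\<^esub> x)"
  by (simp add: shift_def)

lemma M_one_val: "w \<in> carrier X \<Longrightarrow> \<one>\<^bsub>M\<^esub> w = \<one>\<^bsub>C\<^esub>"
  by simp

lemma shift_shift:
  assumes "v \<in> carrier M" "x \<in> carrier X" "y \<in> carrier X"
  shows "shift x (shift y v) = shift (x \<otimes>\<^bsub>X\<^esub> y) v"
  using assms by (intro M_eqI shift_closed) (auto simp: shift_val X.m_assoc)

lemma shift_one: "v \<in> carrier M \<Longrightarrow> shift \<one>\<^bsub>X\<^esub> v = v"
  by (intro M_eqI shift_closed) (auto simp: shift_val)

lemma diff_one: "v \<in> carrier M \<Longrightarrow> diff \<one>\<^bsub>X\<^esub> v = \<one>\<^bsub>M\<^esub>"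
  unfolding diff_def by (simp only: shift_one M.r_inv)

text \<open>Both this and \<open>diff_diff\<close> express that the group ring of \<open>X\<close>
  is commutative. This one makes the generating sets used later stable under conjugation.\<close>

lemma shift_diff:
  assumes "v \<in> carrier M" "x \<in> carrier X" "y \<in> carrier X"
  shows "shift x (diff y v) = diff y (shift x v)"
  using assms
  by (intro M_eqI shift_closed diff_closed)
    (auto simp: shift_val diff_val shift_closed X.m_ac)

lemma diff_diff:
  assumes "v \<in> carrier M" "x \<in> carrier X" "y \<in> carrier X"
  shows "diff x (diff y v) = diff y (diff x v)"
  using assms
  by (intro M_eqI diff_closed)
    (auto simp: diff_val diff_closed X.m_ac C.m_ac M_val C.inv_mult)

text \<open>The group-ring identity \<open>x y - 1 = x (y - 1) + (x - 1)\<close>.\<close>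

lemma diff_mult_left:
  assumes "v \<in> carrier M" "x \<in> carrier X" "y \<in> carrier X"
  shows "diff (x \<otimes>\<^bsub>X\<^esub> y) v = shift x (diff y v) \<otimes>\<^bsub>M\<^esub> diff x v"
proof (rule M_eqI)
  fix w assume w: "w \<in> carrier X"
  have "diff (x \<otimes>\<^bsub>X\<^esub> y) v w = v (w \<otimes>\<^bsub>X\<^esub> x \<otimes>\<^bsub>X\<^esub> y) \<otimes>\<^bsub>C\<^esub> inv\<^bsub>C\<^esub> v w"
    using assms w by (simp add: diff_val X.m_assoc)
  also have "\<dots> = (v (w \<otimes>\<^bsub>X\<^esub> x \<otimes>\<^bsub>X\<^esub> y) \<otimes>\<^bsub>C\<^esub> inv\<^bsub>C\<^esub> v (w \<otimes>\<^bsub>X\<^esub> x))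
      \<otimes>\<^bsub>C\<^esub> (v (w \<otimes>\<^bsub>X\<^esub> x) \<otimes>\<^bsub>C\<^esub> inv\<^bsub>C\<^esub> v w)"
    using assms w M_val[of v] by (simp add: C.m_assoc) (simp flip: C.m_assoc)
  finally show "diff (x \<otimes>\<^bsub>X\<^esub> y) v w = (shift x (diff y v) \<otimes>\<^bsub>M\<^esub> diff x v) w"
    using assms w by (simp add: shift_val diff_val)
qed (use assms in \<open>blast intro: M.m_closed shift_closed diff_closed X.m_closed\<close>)+

section \<open>Consequences of finite support: cancelling \<open>z - 1\<close> and dividing by
  it\<close>

lemma eventually_one:
  assumes "v \<in> carrier M" "w \<in> carrier X" "z \<in> carrier X" "inj (\<lambda>k :: nat. z [^]\<^bsub>X\<^esub> k)"
  shows "\<exists>N. \<forall>k\<ge>(N :: nat). v (w \<otimes>\<^bsub>X\<^esub> z [^]\<^bsub>X\<^esub> k) = \<one>\<^bsub>C\<^esub>"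
proof -
  have "inj (\<lambda>k :: nat. w \<otimes>\<^bsub>X\<^esub> z [^]\<^bsub>X\<^esub> k)"
    using assms by (auto simp: inj_def)
  moreover have "finite {w \<in> carrier X. v w \<noteq> \<one>\<^bsub>C\<^esub>}"
    using assms(1) by (simp add: mem_M)
  ultimately have "finite ((\<lambda>k :: nat. w \<otimes>\<^bsub>X\<^esub> z [^]\<^bsub>X\<^esub> k) -` {w \<in> carrier X. v w \<noteq> \<one>\<^bsub>C\<^esub>})"
    by (rule finite_vimageI[rotated])
  then obtain N where "\<forall>k \<in> (\<lambda>k :: nat. w \<otimes>\<^bsub>X\<^esub> z [^]\<^bsub>X\<^esub> k) -` {w \<in> carrier X. v w \<noteq> \<one>\<^bsub>C\<^esub>}. k < N"
    using finite_nat_set_iff_bounded by blast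
  then show ?thesis
    using assms by (intro exI[of _ N]) force
qed

text \<open>An element fixed by \<open>z\<close> is constant along each ray \<open>w z^k\<close>,
  and an injective ray leaves the finite support.\<close>

lemma diff_eq_one:
  assumes "v \<in> carrier M" "z \<in> carrier X" "inj (\<lambda>k :: nat. z [^]\<^bsub>X\<^esub> k)" "diff z v = \<one>\<^bsub>M\<^esub>"
  shows "v = \<one>\<^bsub>M\<^esub>"
proof (rule M_eqI)
  fix w assume w: "w \<in> carrier X"
  have step: "v (w \<otimes>\<^bsub>X\<^esub> z) = v w" if "w \<in> carrier X" for w
  proof -
    have "v (w \<otimes>\<^bsub>X\<^esub> z) \<otimes>\<^bsub>C\<^esub> inv\<^bsub>C\<^esub> v w = \<one>\<^bsub>C\<^esub>"
      using diff_val[OF assms(1) that, of z] assms(4) that by simp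
    then show ?thesis
      using assms that by (simp add: C.mult_inv_eq_one_iff M_val)
  qed
  have "v (w \<otimes>\<^bsub>X\<^esub> z [^]\<^bsub>X\<^esub> k) = v w" for k :: nat
  proof (induction k)
    case (Suc k)
    then show ?case using step[of "w \<otimes>\<^bsub>X\<^esub> z [^]\<^bsub>X\<^esub> k"] w assms by (simp add: X.m_assoc)
  qed (use w in simp)
  then show "v w = \<one>\<^bsub>M\<^esub> w"
    using eventually_one[OF assms(1) w assms(2,3)] w by auto
qed (use assms(1) M.one_closed in blast)+

text \<open>The quotient is the function \<open>w \<mapsto> - \<Sum>\<^sub>k s (w z\<^sup>k)\<close>; comparing with \<open>t\<close> along the powers of
  \<open>z'\<close> shows that it has finite support.\<close>

lemma diff_divides:
  assumes zz': "independent_powers X z z'"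
    and z: "z \<in> carrier X" and z': "z' \<in> carrier X"
    and s: "s \<in> carrier M" and t: "t \<in> carrier M"
    and eq: "diff z' s = diff z t"
  shows "s \<in> diff z ` carrier M"
proof -
  have inj: "inj (\<lambda>k :: nat. z [^]\<^bsub>X\<^esub> k)"
    by (rule X.independent_inj_pow[OF zz' z z'])
  have vanish: "\<exists>N. \<forall>k\<ge>(N :: nat). v (w \<otimes>\<^bsub>X\<^esub> z [^]\<^bsub>X\<^esub> k) = \<one>\<^bsub>C\<^esub>"
    if "v \<in> carrier M" "w \<in> carrier X" for v w
    using that by (rule eventually_one) (rule z inj)+
  \<comment> \<open>Additively \<open>q\<close> is the sum of all \<open>z^k s\<close>, the
    geometric series for \<open>s / (1 - z)\<close>. Keeping only the exponents with a nontrivial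
    factor makes the index set finite for \<open>w\<close> in \<open>X\<close>.\<close>
  define q where "q w = finprod C (\<lambda>k. s (w \<otimes>\<^bsub>X\<^esub> z [^]\<^bsub>X\<^esub> k)) {k :: nat. s (w \<otimes>\<^bsub>X\<^esub> z [^]\<^bsub>X\<^esub> k) \<noteq> \<one>\<^bsub>C\<^esub>}"
    for w
  have s_val: "s w \<in> carrier C" if "w \<in> carrier X" for w
    using s that by (rule M_val)
  have q_eq: "q w = finprod C (\<lambda>k. s (w \<otimes>\<^bsub>X\<^esub> z [^]\<^bsub>X\<^esub> k)) {..N}"
    if "w \<in> carrier X" "\<forall>k\<ge>N. s (w \<otimes>\<^bsub>X\<^esub> z [^]\<^bsub>X\<^esub> k) = \<one>\<^bsub>C\<^esub>" for w and N :: nat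
    unfolding q_def using that z
    by (intro C.finprod_mono_neutral_cong_left) (auto intro!: s_val, metis nat_le_linear)
  have q_val: "q w \<in> carrier C" if "w \<in> carrier X" for w
    unfolding q_def using that z by (intro C.finprod_closed) (auto intro!: s_val)
  have q_step: "q w = q (w \<otimes>\<^bsub>X\<^esub> z) \<otimes>\<^bsub>C\<^esub> s w" if w: "w \<in> carrier X" for w
  proof -
    obtain N :: nat where N: "\<forall>k\<ge>N. s (w \<otimes>\<^bsub>X\<^esub> z [^]\<^bsub>X\<^esub> k) = \<one>\<^bsub>C\<^esub>"
      using vanish[OF s w] by blast
    have shift: "w \<otimes>\<^bsub>X\<^esub> z [^]\<^bsub>X\<^esub> Suc k = w \<otimes>\<^bsub>X\<^esub> z \<otimes>\<^bsub>X\<^esub> z [^]\<^bsub>X\<^esub> k" for k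
      using w z by (simp add: X.m_ac)
    \<comment> \<open>The bound \<open>Suc N\<close> leaves exactly \<open>{..N}\<close>, hence
      \<open>q (w z)\<close>, once the factor with exponent 0 is split off.\<close>
    have "q w = finprod C (\<lambda>k. s (w \<otimes>\<^bsub>X\<^esub> z [^]\<^bsub>X\<^esub> k)) {..Suc N}"
      using w N by (intro q_eq) auto
    also have "\<dots> = finprod C (\<lambda>k. s (w \<otimes>\<^bsub>X\<^esub> z [^]\<^bsub>X\<^esub> Suc k)) {..N}
        \<otimes>\<^bsub>C\<^esub> s (w \<otimes>\<^bsub>X\<^esub> z [^]\<^bsub>X\<^esub> (0 :: nat))"
      using w z by (intro C.finprod_Suc2) (auto intro!: s_val)
    also have "finprod C (\<lambda>k. s (w \<otimes>\<^bsub>X\<^esub> z [^]\<^bsub>X\<^esub> Suc k)) {..N} = q (w \<otimes>\<^bsub>X\<^esub> z)"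
      unfolding shift using w z
    proof (intro q_eq[symmetric] allI impI)
      fix k assume "N \<le> k"
      then have "N \<le> Suc k" by simp
      with N show "s (w \<otimes>\<^bsub>X\<^esub> z \<otimes>\<^bsub>X\<^esub> z [^]\<^bsub>X\<^esub> k) = \<one>\<^bsub>C\<^esub>"
        unfolding shift[symmetric] by blast
    qed simp
    finally show ?thesis using w by simp
  qed
  have q_ne: "\<exists>k :: nat. s (w \<otimes>\<^bsub>X\<^esub> z [^]\<^bsub>X\<^esub> k) \<noteq> \<one>\<^bsub>C\<^esub>" if "q w \<noteq> \<one>\<^bsub>C\<^esub>" for w
  proof (rule ccontr)
    assume "\<not> ?thesis"
    then have "q w = \<one>\<^bsub>C\<^esub>" by (simp add: q_def)
    with that show False by contradiction
  qed
  \<comment> \<open>Additively \<open>g = (z' - 1) q + t\<close>. It is invariant under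
    \<open>z\<close> and trivial far out on every \<open>z\<close>-ray, hence trivial, so
    \<open>q\<close> changes along \<open>z'\<close> only where \<open>t\<close> is
    nontrivial.\<close>
  define g where "g w = q (w \<otimes>\<^bsub>X\<^esub> z') \<otimes>\<^bsub>C\<^esub> inv\<^bsub>C\<^esub> q w \<otimes>\<^bsub>C\<^esub> t w" for w
  have t_val: "t w \<in> carrier C" if "w \<in> carrier X" for w
    using t that by (rule M_val)
  have g_step: "g (w \<otimes>\<^bsub>X\<^esub> z) = g w" if w: "w \<in> carrier X" for w
  proof -
    have "t (w \<otimes>\<^bsub>X\<^esub> z) \<otimes>\<^bsub>C\<^esub> inv\<^bsub>C\<^esub> t w = s (w \<otimes>\<^bsub>X\<^esub> z') \<otimes>\<^bsub>C\<^esub> inv\<^bsub>C\<^esub> s w"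
      using fun_cong[OF eq, of w] w s t by (simp add: diff_val)
    then have t_eq: "t (w \<otimes>\<^bsub>X\<^esub> z) = s (w \<otimes>\<^bsub>X\<^esub> z') \<otimes>\<^bsub>C\<^esub> inv\<^bsub>C\<^esub> s w \<otimes>\<^bsub>C\<^esub> t w"
      using w z z' by (metis C.inv_solve_right C.m_closed C.inv_closed X.m_closed s_val t_val)
    have "q (w \<otimes>\<^bsub>X\<^esub> z') = q (w \<otimes>\<^bsub>X\<^esub> z \<otimes>\<^bsub>X\<^esub> z') \<otimes>\<^bsub>C\<^esub> s (w \<otimes>\<^bsub>X\<^esub> z')"
      using q_step[of "w \<otimes>\<^bsub>X\<^esub> z'"] w z z' by (simp add: X.m_ac)
    then show ?thesis
      unfolding g_def t_eq q_step[OF w] using w z z' q_val[of "w \<otimes>\<^bsub>X\<^esub> z \<otimes>\<^bsub>X\<^esub> z'"]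
        q_val[of "w \<otimes>\<^bsub>X\<^esub> z"] s_val[of "w \<otimes>\<^bsub>X\<^esub> z'"] s_val[of w] t_val[of w]
      by (simp add: C.inv_mult C.m_ac)
  qed
  have g_one: "g w = \<one>\<^bsub>C\<^esub>" if w: "w \<in> carrier X" for w
  proof -
    have iter: "g (w \<otimes>\<^bsub>X\<^esub> z [^]\<^bsub>X\<^esub> k) = g w" for k :: nat
    proof (induction k)
      case (Suc k)
      then show ?case using g_step[of "w \<otimes>\<^bsub>X\<^esub> z [^]\<^bsub>X\<^esub> k"] w z by (simp add: X.m_assoc)
    qed (use w in simp)
    obtain N1 :: nat where N1: "\<forall>k\<ge>N1. s (w \<otimes>\<^bsub>X\<^esub> z [^]\<^bsub>X\<^esub> k) = \<one>\<^bsub>C\<^esub>"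
      using vanish[OF s w] by blast
    obtain N2 :: nat where N2: "\<forall>k\<ge>N2. s (w \<otimes>\<^bsub>X\<^esub> z' \<otimes>\<^bsub>X\<^esub> z [^]\<^bsub>X\<^esub> k) = \<one>\<^bsub>C\<^esub>"
      using vanish[OF s, of "w \<otimes>\<^bsub>X\<^esub> z'"] w z' by auto
    obtain N3 :: nat where N3: "\<forall>k\<ge>N3. t (w \<otimes>\<^bsub>X\<^esub> z [^]\<^bsub>X\<^esub> k) = \<one>\<^bsub>C\<^esub>"
      using vanish[OF t w] by blast
    \<comment> \<open>The sum lies beyond all three thresholds, so \<open>t\<close> and both values
      of \<open>q\<close> entering \<open>g\<close> are trivial at \<open>w z^N\<close>.\<close>
    define N where "N = N1 + N2 + N3"
    have "q (w \<otimes>\<^bsub>X\<^esub> z [^]\<^bsub>X\<^esub> N) = \<one>\<^bsub>C\<^esub>"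
    proof (rule ccontr)
      assume "q (w \<otimes>\<^bsub>X\<^esub> z [^]\<^bsub>X\<^esub> N) \<noteq> \<one>\<^bsub>C\<^esub>"
      from q_ne[OF this] show False
        using w z N1 by (auto simp: X.m_assoc X.nat_pow_mult N_def)
    qed
    moreover have "q (w \<otimes>\<^bsub>X\<^esub> z [^]\<^bsub>X\<^esub> N \<otimes>\<^bsub>X\<^esub> z') = \<one>\<^bsub>C\<^esub>"
    proof (rule ccontr)
      assume "q (w \<otimes>\<^bsub>X\<^esub> z [^]\<^bsub>X\<^esub> N \<otimes>\<^bsub>X\<^esub> z') \<noteq> \<one>\<^bsub>C\<^esub>"
      then obtain k :: nat where "s (w \<otimes>\<^bsub>X\<^esub> z [^]\<^bsub>X\<^esub> N \<otimes>\<^bsub>X\<^esub> z' \<otimes>\<^bsub>X\<^esub> z [^]\<^bsub>X\<^esub> k) \<noteq> \<one>\<^bsub>C\<^esub>"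
        using q_ne by blast
      moreover have "w \<otimes>\<^bsub>X\<^esub> z [^]\<^bsub>X\<^esub> N \<otimes>\<^bsub>X\<^esub> z' \<otimes>\<^bsub>X\<^esub> z [^]\<^bsub>X\<^esub> k = w \<otimes>\<^bsub>X\<^esub> z' \<otimes>\<^bsub>X\<^esub> z [^]\<^bsub>X\<^esub> (N + k)"
        using w z z' by (simp add: X.m_ac flip: X.nat_pow_mult)
      ultimately show False
        using N2 by (simp add: N_def)
    qed
    moreover have "t (w \<otimes>\<^bsub>X\<^esub> z [^]\<^bsub>X\<^esub> N) = \<one>\<^bsub>C\<^esub>"
      using N3 by (simp add: N_def)
    ultimately have "g (w \<otimes>\<^bsub>X\<^esub> z [^]\<^bsub>X\<^esub> N) = \<one>\<^bsub>C\<^esub>"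
      by (simp add: g_def)
    then show ?thesis by (simp add: iter)
  qed
  have q_z': "q (w \<otimes>\<^bsub>X\<^esub> z') = q w" if "w \<in> carrier X" "t w = \<one>\<^bsub>C\<^esub>" for w
  proof -
    have "q (w \<otimes>\<^bsub>X\<^esub> z') \<otimes>\<^bsub>C\<^esub> inv\<^bsub>C\<^esub> q w = \<one>\<^bsub>C\<^esub>"
      using g_one[OF that(1)] that z' q_val by (simp add: g_def)
    then show ?thesis
      using that z' q_val by (simp add: C.mult_inv_eq_one_iff)
  qed
  let ?supp = "\<lambda>v. {w \<in> carrier X. v w \<noteq> \<one>\<^bsub>C\<^esub>}"
  have fin_s: "finite (?supp s)" and fin_t: "finite (?supp t)"
    using s t by (simp_all add: mem_M)
  \<comment> \<open>If \<open>t\<close> vanished on the whole ray \<open>w z'^j\<close>, then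
    \<open>q\<close> would be constant and nontrivial there. Every \<open>j\<close> would yield a
    point \<open>w z'^j z^k\<close> in the support of \<open>s\<close>, and independence makes these
    infinitely many points distinct.\<close>
  have t_ne: "\<exists>j :: nat. t (w \<otimes>\<^bsub>X\<^esub> z' [^]\<^bsub>X\<^esub> j) \<noteq> \<one>\<^bsub>C\<^esub>"
    if w: "w \<in> carrier X" and qw: "q w \<noteq> \<one>\<^bsub>C\<^esub>" for w
  proof (rule ccontr)
    assume "\<not> ?thesis"
    then have t1: "t (w \<otimes>\<^bsub>X\<^esub> z' [^]\<^bsub>X\<^esub> j) = \<one>\<^bsub>C\<^esub>" for j :: nat by blast
    have "q (w \<otimes>\<^bsub>X\<^esub> z' [^]\<^bsub>X\<^esub> j) = q w" for j :: nat
    proof (induction j)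
      case (Suc j)
      then show ?case
        using q_z'[of "w \<otimes>\<^bsub>X\<^esub> z' [^]\<^bsub>X\<^esub> j"] t1[of j] w z' by (simp add: X.m_assoc)
    qed (use w in simp)
    then have "\<exists>k :: nat. s (w \<otimes>\<^bsub>X\<^esub> z' [^]\<^bsub>X\<^esub> j \<otimes>\<^bsub>X\<^esub> z [^]\<^bsub>X\<^esub> k) \<noteq> \<one>\<^bsub>C\<^esub>" for j :: nat
      using q_ne qw by simp
    then obtain \<kappa> :: "nat \<Rightarrow> nat"
      where \<kappa>: "\<And>j. s (w \<otimes>\<^bsub>X\<^esub> z' [^]\<^bsub>X\<^esub> j \<otimes>\<^bsub>X\<^esub> z [^]\<^bsub>X\<^esub> \<kappa> j) \<noteq> \<one>\<^bsub>C\<^esub>"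
      by metis
    have "inj (\<lambda>j. w \<otimes>\<^bsub>X\<^esub> z' [^]\<^bsub>X\<^esub> j \<otimes>\<^bsub>X\<^esub> z [^]\<^bsub>X\<^esub> \<kappa> j)"
    proof (rule injI)
      fix i j assume "w \<otimes>\<^bsub>X\<^esub> z' [^]\<^bsub>X\<^esub> i \<otimes>\<^bsub>X\<^esub> z [^]\<^bsub>X\<^esub> \<kappa> i = w \<otimes>\<^bsub>X\<^esub> z' [^]\<^bsub>X\<^esub> j \<otimes>\<^bsub>X\<^esub> z [^]\<^bsub>X\<^esub> \<kappa> j"
      then have "z [^]\<^bsub>X\<^esub> \<kappa> i \<otimes>\<^bsub>X\<^esub> z' [^]\<^bsub>X\<^esub> i = z [^]\<^bsub>X\<^esub> \<kappa> j \<otimes>\<^bsub>X\<^esub> z' [^]\<^bsub>X\<^esub> j"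
        using w z z' by (simp add: X.m_assoc X.m_comm[of "z' [^]\<^bsub>X\<^esub> _"])
      then show "i = j" by (rule independent_powersD(2)[OF zz'])
    qed
    moreover have "range (\<lambda>j. w \<otimes>\<^bsub>X\<^esub> z' [^]\<^bsub>X\<^esub> j \<otimes>\<^bsub>X\<^esub> z [^]\<^bsub>X\<^esub> \<kappa> j) \<subseteq> ?supp s"
      using w z z' \<kappa> by auto
    ultimately show False
      using fin_s finite_subset range_inj_infinite by blast
  qed
  \<comment> \<open>The implication stands inside the existential so that \<open>k\<close> and
    \<open>j\<close> can be chosen as total functions.\<close>
  have "\<exists>(k :: nat) (j :: nat). w \<in> ?supp q \<longrightarrow>
      s (w \<otimes>\<^bsub>X\<^esub> z [^]\<^bsub>X\<^esub> k) \<noteq> \<one>\<^bsub>C\<^esub> \<and> t (w \<otimes>\<^bsub>X\<^esub> z' [^]\<^bsub>X\<^esub> j) \<noteq> \<one>\<^bsub>C\<^esub>" for w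
    using q_ne t_ne by blast
  then obtain k j :: "'x \<Rightarrow> nat" where kj: "\<And>w. w \<in> ?supp q \<Longrightarrow>
      s (w \<otimes>\<^bsub>X\<^esub> z [^]\<^bsub>X\<^esub> k w) \<noteq> \<one>\<^bsub>C\<^esub> \<and> t (w \<otimes>\<^bsub>X\<^esub> z' [^]\<^bsub>X\<^esub> j w) \<noteq> \<one>\<^bsub>C\<^esub>"
    by metis
  \<comment> \<open>From \<open>w\<close> the support of \<open>s\<close> is reached along
    \<open>z\<close> and that of \<open>t\<close> along \<open>z'\<close>. By independence the two
    endpoints determine \<open>w\<close>, so the support of \<open>q\<close> embeds in a finite
    product.\<close>
  let ?h = "\<lambda>w. (w \<otimes>\<^bsub>X\<^esub> z [^]\<^bsub>X\<^esub> k w, w \<otimes>\<^bsub>X\<^esub> z' [^]\<^bsub>X\<^esub> j w)"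
  have "inj_on ?h (?supp q)"
  proof (rule inj_onI)
    fix v w assume "v \<in> ?supp q" "w \<in> ?supp q" and h: "?h v = ?h w"
    then have v: "v \<in> carrier X" and w: "w \<in> carrier X" by auto
    \<comment> \<open>Multiplying the equal components crosswise and cancelling \<open>v w\<close>
      gives a relation between powers of \<open>z\<close> and \<open>z'\<close> without
      inverses.\<close>
    have "(v \<otimes>\<^bsub>X\<^esub> w) \<otimes>\<^bsub>X\<^esub> (z [^]\<^bsub>X\<^esub> k v \<otimes>\<^bsub>X\<^esub> z' [^]\<^bsub>X\<^esub> j w)
        = (v \<otimes>\<^bsub>X\<^esub> z [^]\<^bsub>X\<^esub> k v) \<otimes>\<^bsub>X\<^esub> (w \<otimes>\<^bsub>X\<^esub> z' [^]\<^bsub>X\<^esub> j w)"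
      using v w z z' by (simp add: X.m_ac)
    also have "\<dots> = (w \<otimes>\<^bsub>X\<^esub> z [^]\<^bsub>X\<^esub> k w) \<otimes>\<^bsub>X\<^esub> (v \<otimes>\<^bsub>X\<^esub> z' [^]\<^bsub>X\<^esub> j v)"
      using h by simp
    also have "\<dots> = (v \<otimes>\<^bsub>X\<^esub> w) \<otimes>\<^bsub>X\<^esub> (z [^]\<^bsub>X\<^esub> k w \<otimes>\<^bsub>X\<^esub> z' [^]\<^bsub>X\<^esub> j v)"
      using v w z z' by (simp add: X.m_ac)
    finally have "z [^]\<^bsub>X\<^esub> k v \<otimes>\<^bsub>X\<^esub> z' [^]\<^bsub>X\<^esub> j w = z [^]\<^bsub>X\<^esub> k w \<otimes>\<^bsub>X\<^esub> z' [^]\<^bsub>X\<^esub> j v"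
      using v w z z' by simp
    then have "k v = k w" by (rule independent_powersD(1)[OF zz'])
    then show "v = w" using h v w z by simp
  qed
  moreover have "?h ` ?supp q \<subseteq> ?supp s \<times> ?supp t"
  proof
    fix x assume "x \<in> ?h ` ?supp q"
    then obtain w where "w \<in> ?supp q" "x = ?h w" by blast
    then show "x \<in> ?supp s \<times> ?supp t" using kj[of w] z z' by simp
  qed
  ultimately have fin_q: "finite (?supp q)"
    by (rule inj_on_finite) (rule finite_cartesian_product[OF fin_s fin_t])
  \<comment> \<open>\<open>q_step\<close> reads \<open>s = q - z q\<close> additively, so the
    quotient by \<open>z - 1\<close> is the inverse of \<open>q\<close>. The restriction makes it
    extensional, as membership in \<open>M\<close> demands.\<close>
  define r where "r = (\<lambda>w\<in>carrier X. inv\<^bsub>C\<^esub> q w)"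
  have "?supp r = ?supp q"
    using q_val by (auto simp: r_def)
  then have r: "r \<in> carrier M"
    using q_val fin_q by (simp add: mem_M) (simp add: r_def)
  have "s = diff z r"
  proof (rule M_eqI)
    fix w assume w: "w \<in> carrier X"
    then show "s w = diff z r w"
      using q_step[OF w] q_val[of w] q_val[of "w \<otimes>\<^bsub>X\<^esub> z"] s_val[OF w] z r
      by (simp add: diff_val) (simp add: r_def flip: C.m_assoc)
  qed (use s r z diff_closed in blast)+
  with r show ?thesis by blast
qed

end

section \<open>Virtual endomorphisms of wreath products\<close>

text \<open>The subgroup generated by a conjugation-stable set is normal, and \<open>f\<close> maps
  it onto the subgroup generated by the images. Thus invariance need only be checked on
  generators.\<close>

lemma (in group) not_simple_virtual_endomorphism:
  assumes Y: "Y \<subseteq> H" "f ` Y \<subseteq> generate G Y" "\<not> Y \<subseteq> {\<one>}"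
    and conj: "\<And>y g. y \<in> Y \<Longrightarrow> g \<in> carrier G \<Longrightarrow> g \<otimes> y \<otimes> inv g \<in> Y"
  shows "\<not> simple_virtual_endomorphism G H f"
proof
  assume simple: "simple_virtual_endomorphism G H f"
  then have H: "subgroup H G" and f: "f \<in> hom (G\<lparr>carrier := H\<rparr>) G"
    by (auto simp: simple_virtual_endomorphism_def virtual_endomorphism_def)
  interpret f: group_hom "G\<lparr>carrier := H\<rparr>" G f
    using subgroup_imp_group[OF H] f is_group by (simp add: group_hom_def group_hom_axioms_def)
  have YG: "Y \<subseteq> carrier G"
    using Y(1) subgroup.subset[OF H] by blast
  have "generate G Y \<subseteq> H"
    by (rule generate_subgroup_incl[OF Y(1) H])
  moreover have "generate G Y \<lhd> G"
    using YG conj by (rule normal_generateI)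
  moreover have "f ` generate G Y \<subseteq> generate G Y"
  proof -
    have "f ` generate G Y = generate G (f ` Y)"
      \<comment> \<open>\<open>generate_consistent\<close> identifies the subgroup generated inside
        \<open>H\<close> with the one generated in \<open>G\<close>.\<close>
      using f.generate_img[of Y] Y(1) generate_consistent[OF Y(1) H] by simp
    also have "\<dots> \<subseteq> generate G Y"
      using Y(2) generate_is_subgroup[OF YG] by (rule generate_subgroup_incl)
    finally show ?thesis .
  qed
  ultimately have "generate G Y = {\<one>}"
    using simple unfolding simple_virtual_endomorphism_def by blast
  then show False
    using Y(3) generate.incl[of _ Y G] by blast
qed

section \<open>Conjugation and commutators in the wreath product\<close>

context abelian_wreath
begin

abbreviation W where "W \<equiv> restricted_wreath C X"

text \<open>This embeds the whole module \<open>M\<close>, whereas \<open>wreath_base\<close> embeds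
  a single copy of \<open>C\<close>.\<close>

definition base :: "('x \<Rightarrow> 'c) \<Rightarrow> ('x \<Rightarrow> 'c) \<times> 'x" where
  "base v = (v, \<one>\<^bsub>X\<^esub>)"

sublocale W: group W
  by (rule group_restricted_wreath[OF C.is_group X.is_group])

lemma carrier_W: "carrier W = carrier M \<times> carrier X"
  by (simp add: restricted_wreath_def)

lemma mult_W: "(u, x) \<otimes>\<^bsub>W\<^esub> (v, y) = (u \<otimes>\<^bsub>M\<^esub> shift x v, x \<otimes>\<^bsub>X\<^esub> y)"
  by (simp add: restricted_wreath_def shift_def)

lemma one_W: "\<one>\<^bsub>W\<^esub> = base \<one>\<^bsub>M\<^esub>"
  by (simp add: restricted_wreath_def base_def)

sublocale snd: group_hom W X snd
  by unfold_locales (auto simp: hom_def carrier_W mult_W)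

sublocale base: group_hom M W base
proof unfold_locales
  show "base \<in> hom M W"
  proof (rule homI)
    show "base v \<in> carrier W" if "v \<in> carrier M" for v
      using that by (simp add: base_def carrier_W)
    show "base (u \<otimes>\<^bsub>M\<^esub> v) = base u \<otimes>\<^bsub>W\<^esub> base v"
      if "u \<in> carrier M" "v \<in> carrier M" for u v
      using that by (simp only: base_def mult_W shift_one X.r_one X.one_closed)
  qed
qed

lemma base_eq_iff: "base u = base v \<longleftrightarrow> u = v"
  by (simp add: base_def)

lemma ex_base: "g \<in> carrier W \<Longrightarrow> snd g = \<one>\<^bsub>X\<^esub> \<Longrightarrow> \<exists>v\<in>carrier M. g = base v"
  by (auto simp: carrier_W base_def)

lemma conj_base:
  assumes "g \<in> carrier W" "v \<in> carrier M"
  shows "g \<otimes>\<^bsub>W\<^esub> base v \<otimes>\<^bsub>W\<^esub> inv\<^bsub>W\<^esub> g = base (shift (snd g) v)"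
proof -
  obtain u x where g: "g = (u, x)" and u: "u \<in> carrier M" and x: "x \<in> carrier X"
    using assms(1) by (auto simp: carrier_W)
  \<comment> \<open>Comparing \<open>g b\<close> with \<open>b' g\<close> avoids computing inverses
    in \<open>W\<close>; the base component of \<open>g\<close> drops out because \<open>M\<close>
    is commutative.\<close>
  have "g \<otimes>\<^bsub>W\<^esub> base v = base (shift x v) \<otimes>\<^bsub>W\<^esub> g"
    unfolding g base_def mult_W
    using u x assms(2) by (simp only: shift_one shift_closed M.m_comm X.r_one X.l_one)
  moreover have "base (shift x v) \<in> carrier W"
    using assms(2) x by (intro base.hom_closed shift_closed)
  ultimately have "g \<otimes>\<^bsub>W\<^esub> base v \<otimes>\<^bsub>W\<^esub> inv\<^bsub>W\<^esub> g = base (shift x v)"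
    using assms(1) by (simp add: W.m_assoc)
  then show ?thesis by (simp add: g)
qed

lemma commutator_base:
  assumes "g \<in> carrier W" "v \<in> carrier M"
  shows "g \<otimes>\<^bsub>W\<^esub> base v \<otimes>\<^bsub>W\<^esub> inv\<^bsub>W\<^esub> g \<otimes>\<^bsub>W\<^esub> inv\<^bsub>W\<^esub> (base v) = base (diff (snd g) v)"
proof -
  have "shift (snd g) v \<in> carrier M"
    using assms by (auto simp: carrier_W intro: shift_closed)
  then show ?thesis
    unfolding conj_base[OF assms] diff_def
    using assms(2) by (simp only: base.hom_mult base.hom_inv M.inv_closed)
qed

lemma M_pow_val:
  fixes n :: nat
  assumes "v \<in> carrier M" "w \<in> carrier X"
  shows "(v [^]\<^bsub>M\<^esub> n) w = v w [^]\<^bsub>C\<^esub> n"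
  using assms by (induction n) (auto simp: M_val)

lemma single_closed: "c \<in> carrier C \<Longrightarrow> single C X w c \<in> carrier M"
  by (auto simp: mem_M single_def intro: finite_subset[of _ "{w}"])

end

text \<open>Here \<open>onto\<close> is the condition \<open>A H = G\<close> read modulo the base
  group. \<open>ex_independent\<close> carries what is used of a free abelian group of rank at least
  2, including torsion-freeness.\<close>

locale wreath_virtual_endomorphism = abelian_wreath C X
  for C :: "('c, 'm) monoid_scheme" and X :: "('x, 'n) monoid_scheme" +
  fixes H :: "(('x \<Rightarrow> 'c) \<times> 'x) set" and f :: "('x \<Rightarrow> 'c) \<times> 'x \<Rightarrow> ('x \<Rightarrow> 'c) \<times> 'x"
    and p :: nat
  assumes virtual_endomorphism: "virtual_endomorphism (restricted_wreath C X) H f"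
    and onto: "x \<in> carrier X \<Longrightarrow> \<exists>h\<in>H. snd h = x"
    and ex_independent: "x \<in> carrier X \<Longrightarrow> x \<noteq> \<one>\<^bsub>X\<^esub> \<Longrightarrow> \<exists>y\<in>carrier X. independent_powers X x y"
    and exponent_pos: "p > 0"
    and exponent: "c \<in> carrier C \<Longrightarrow> c [^]\<^bsub>C\<^esub> p = \<one>\<^bsub>C\<^esub>"
    and nontrivial: "carrier C \<noteq> {\<one>\<^bsub>C\<^esub>}"
begin

section \<open>The intersection of \<open>H\<close> with the base group\<close>

lemma subgroup_H: "subgroup H W"
  using virtual_endomorphism by (simp add: virtual_endomorphism_def)

sublocale H: subgroup H W
  by (rule subgroup_H)

lemma finite_index: "finite (rcosets\<^bsub>W\<^esub> H)"
  using virtual_endomorphism by (simp add: virtual_endomorphism_def)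

sublocale f: group_hom "W\<lparr>carrier := H\<rparr>" W f
  using W.subgroup_imp_group[OF subgroup_H] virtual_endomorphism W.is_group
  by (simp add: virtual_endomorphism_def group_hom_def group_hom_axioms_def)

lemma f_closed: "h \<in> H \<Longrightarrow> f h \<in> carrier W"
  using f.hom_closed by simp

lemma f_mult: "g \<in> H \<Longrightarrow> h \<in> H \<Longrightarrow> f (g \<otimes>\<^bsub>W\<^esub> h) = f g \<otimes>\<^bsub>W\<^esub> f h"
  using f.hom_mult by simp

lemma f_inv: "h \<in> H \<Longrightarrow> f (inv\<^bsub>W\<^esub> h) = inv\<^bsub>W\<^esub> f h"
  using f.hom_inv[of h] W.m_inv_consistent[OF subgroup_H] by simp

lemma f_one: "f \<one>\<^bsub>W\<^esub> = \<one>\<^bsub>W\<^esub>"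
  using f.hom_one by simp

lemma pow_H: "h \<in> H \<Longrightarrow> h [^]\<^bsub>W\<^esub> n \<in> H" for n :: nat
  by (induction n) auto

lemma f_pow: "h \<in> H \<Longrightarrow> f (h [^]\<^bsub>W\<^esub> n) = f h [^]\<^bsub>W\<^esub> n" for n :: nat
  by (induction n) (simp_all add: f_one f_mult pow_H)

lemma inj_pow:
  assumes "x \<in> carrier X" "x \<noteq> \<one>\<^bsub>X\<^esub>"
  shows "inj (\<lambda>k :: nat. x [^]\<^bsub>X\<^esub> k)"
  using ex_independent[OF assms] X.independent_inj_pow assms(1) by blast

lemma torsion_free:
  assumes "x \<in> carrier X" "x [^]\<^bsub>X\<^esub> n = \<one>\<^bsub>X\<^esub>" "n > (0 :: nat)"
  shows "x = \<one>\<^bsub>X\<^esub>"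
  using inj_pow[OF assms(1)] assms injD[of "\<lambda>k :: nat. x [^]\<^bsub>X\<^esub> k" n 0] by auto

text \<open>Elements of \<open>M\<close> have order dividing \<open>p\<close>, so their images have
  torsion second coordinates, and \<open>X\<close> is torsion-free.\<close>

lemma f_base:
  assumes "v \<in> carrier M" "base v \<in> H"
  shows "\<exists>u\<in>carrier M. f (base v) = base u"
proof (rule ex_base)
  have "v [^]\<^bsub>M\<^esub> p = \<one>\<^bsub>M\<^esub>"
  proof (rule M_eqI)
    fix w assume "w \<in> carrier X"
    then show "(v [^]\<^bsub>M\<^esub> p) w = \<one>\<^bsub>M\<^esub> w"
      using assms(1) by (simp only: M_pow_val exponent M_val M_one_val)
  qed (use assms(1) in \<open>blast intro: M.nat_pow_closed M.one_closed\<close>)+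
  then have "base v [^]\<^bsub>W\<^esub> p = \<one>\<^bsub>W\<^esub>"
    using assms(1) base.hom_nat_pow[of v p] by (simp only: base.hom_one)
  then have "f (base v) [^]\<^bsub>W\<^esub> p = \<one>\<^bsub>W\<^esub>"
    using f_pow[OF assms(2), of p] f_one by simp
  then have "snd (f (base v)) [^]\<^bsub>X\<^esub> p = \<one>\<^bsub>X\<^esub>"
    using snd.hom_nat_pow[OF f_closed[OF assms(2)], of p] by (simp only: snd.hom_one)
  then show "snd (f (base v)) = \<one>\<^bsub>X\<^esub>"
    by (rule torsion_free[OF snd.hom_closed[OF f_closed[OF assms(2)]] _ exponent_pos])
qed (rule f_closed[OF assms(2)])

text \<open>Semilinearity of \<open>f\<close>: multiplication by \<open>x - 1\<close> is a
  commutator with a lift of \<open>x\<close>, and homomorphisms preserve commutators.\<close>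

lemma f_base_diff:
  assumes "v \<in> carrier M" "base v \<in> H" "h \<in> H" "u \<in> carrier M" "f (base v) = base u"
  shows "f (base (diff (snd h) v)) = base (diff (snd (f h)) u)"
proof -
  have "f (base (diff (snd h) v)) = f h \<otimes>\<^bsub>W\<^esub> base u \<otimes>\<^bsub>W\<^esub> inv\<^bsub>W\<^esub> (f h) \<otimes>\<^bsub>W\<^esub> inv\<^bsub>W\<^esub> (base u)"
    using assms by (simp add: f_mult f_inv flip: commutator_base)
  then show ?thesis
    using assms f_closed by (simp add: commutator_base)
qed

text \<open>Every \<open>x\<close> has a lift in \<open>H\<close>, so the intersection of
  \<open>H\<close> and \<open>M\<close> is a submodule.\<close>

lemma base_shift_H:
  assumes "v \<in> carrier M" "base v \<in> H" "x \<in> carrier X"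
  shows "base (shift x v) \<in> H"
proof -
  obtain h where "h \<in> H" "snd h = x"
    using onto[OF assms(3)] by blast
  then show ?thesis
    using assms conj_base[of h v] by (metis H.m_closed H.m_inv_closed H.mem_carrier)
qed

lemma base_shift_H_iff:
  assumes "v \<in> carrier M" "x \<in> carrier X"
  shows "base (shift x v) \<in> H \<longleftrightarrow> base v \<in> H"
proof
  assume "base (shift x v) \<in> H"
  then have "base (shift (inv\<^bsub>X\<^esub> x) (shift x v)) \<in> H"
    using assms by (intro base_shift_H[of "shift x v"] shift_closed X.inv_closed)
  then show "base v \<in> H"
    using assms by (simp only: shift_shift shift_one X.inv_closed X.l_inv)
qed (rule base_shift_H[OF assms(1) _ assms(2)])

lemma base_mult_H:
  assumes "u \<in> carrier M" "v \<in> carrier M" "base u \<in> H" "base v \<in> H"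
  shows "base (u \<otimes>\<^bsub>M\<^esub> v) \<in> H"
  using assms by (simp only: base.hom_mult H.m_closed)

lemma base_diff_H:
  assumes "v \<in> carrier M" "base v \<in> H" "x \<in> carrier X"
  shows "base (diff x v) \<in> H"
  unfolding diff_def using assms
  by (simp only: base.hom_mult base.hom_inv shift_closed M.inv_closed base_shift_H H.m_closed H.m_inv_closed)

lemma base_diff_pow_H:
  fixes n :: nat
  assumes "v \<in> carrier M" "x \<in> carrier X" "base (diff x v) \<in> H"
  shows "base (diff (x [^]\<^bsub>X\<^esub> n) v) \<in> H"
proof (induction n)
  case 0
  have "base (diff (x [^]\<^bsub>X\<^esub> (0 :: nat)) v) = \<one>\<^bsub>W\<^esub>"
    by (simp only: X.nat_pow_0 diff_one assms one_W)
  then show ?case by simp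
next
  case (Suc n)
  have "diff (x [^]\<^bsub>X\<^esub> Suc n) v = shift (x [^]\<^bsub>X\<^esub> n) (diff x v) \<otimes>\<^bsub>M\<^esub> diff (x [^]\<^bsub>X\<^esub> n) v"
    unfolding X.nat_pow_Suc using assms by (intro diff_mult_left X.nat_pow_closed)
  then show ?case
    using assms Suc
    by (simp only: base_mult_H base_shift_H shift_closed diff_closed X.nat_pow_closed)
qed

text \<open>The pigeonhole exponent below depends on \<open>x\<close> and \<open>v\<close> but is at
  most the index of \<open>H\<close>; the factorial is a common multiple of all such
  exponents.\<close>

definition m :: nat where
  "m = fact (card (rcosets\<^bsub>W\<^esub> H))"

lemma m_pos: "m > 0"
  by (simp add: m_def)

lemma base_diff_m_H:
  assumes v: "v \<in> carrier M" and x: "x \<in> carrier X"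
  shows "base (diff (x [^]\<^bsub>X\<^esub> m) v) \<in> H"
proof -
  let ?n = "card (rcosets\<^bsub>W\<^esub> H)"
  let ?b = "\<lambda>i :: nat. base (shift (x [^]\<^bsub>X\<^esub> i) v)"
  have b: "?b i \<in> carrier W" for i
    using v x by (intro base.hom_closed shift_closed X.nat_pow_closed)
  \<comment> \<open>There are \<open>?n + 1\<close> translates for \<open>?n\<close> cosets; two in
    one coset differ by \<open>x^i (x^(j-i) - 1) v\<close>, and the factor \<open>x^i\<close> can be
    removed because \<open>H\<close> meets \<open>M\<close> in a submodule.\<close>
  have "(\<lambda>i. H #>\<^bsub>W\<^esub> ?b i) ` {..?n} \<subseteq> rcosets\<^bsub>W\<^esub> H"
    using b H.subset by (auto intro!: W.rcosetsI)
  then have "card ((\<lambda>i. H #>\<^bsub>W\<^esub> ?b i) ` {..?n}) \<le> ?n"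
    using finite_index by (rule card_mono[rotated])
  then have "\<not> inj_on (\<lambda>i. H #>\<^bsub>W\<^esub> ?b i) {..?n}"
    by (intro pigeonhole) simp
  then obtain i j where ij: "i < j" "j \<le> ?n" and eq: "H #>\<^bsub>W\<^esub> ?b i = H #>\<^bsub>W\<^esub> ?b j"
    unfolding inj_on_def by (metis atMost_iff linorder_neqE_nat)
  have "?b j \<in> H #>\<^bsub>W\<^esub> ?b i"
    unfolding eq by (rule W.rcos_self[OF b subgroup_H])
  then have "?b j \<otimes>\<^bsub>W\<^esub> inv\<^bsub>W\<^esub> ?b i \<in> H"
    by (rule H.rcos_module_imp[OF W.is_group b])
  moreover have "shift (x [^]\<^bsub>X\<^esub> i) (diff (x [^]\<^bsub>X\<^esub> (j - i)) v)
      = shift (x [^]\<^bsub>X\<^esub> j) v \<otimes>\<^bsub>M\<^esub> inv\<^bsub>M\<^esub> shift (x [^]\<^bsub>X\<^esub> i) v"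
  proof -
    have "x [^]\<^bsub>X\<^esub> (j - i) \<otimes>\<^bsub>X\<^esub> x [^]\<^bsub>X\<^esub> i = x [^]\<^bsub>X\<^esub> j"
      using x ij by (simp add: X.nat_pow_mult)
    then show ?thesis
      using v x unfolding diff_def[of _ "shift (x [^]\<^bsub>X\<^esub> i) v"]
      by (simp only: shift_diff X.nat_pow_closed diff_def[of _ "shift (x [^]\<^bsub>X\<^esub> i) v"] shift_shift)
  qed
  ultimately have "base (shift (x [^]\<^bsub>X\<^esub> i) (diff (x [^]\<^bsub>X\<^esub> (j - i)) v)) \<in> H"
    using v x by (simp only: base.hom_mult base.hom_inv shift_closed M.inv_closed X.nat_pow_closed)
  then have H: "base (diff (x [^]\<^bsub>X\<^esub> (j - i)) v) \<in> H"
    using v x by (simp only: base_shift_H_iff diff_closed X.nat_pow_closed)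
  have "(j - i) dvd m"
    unfolding m_def using ij by (intro dvd_fact) auto
  then obtain l where "m = (j - i) * l" by blast
  then show ?thesis
    using base_diff_pow_H[OF v _ H, of l] x by (simp add: X.nat_pow_pow)
qed

section \<open>The two cases for the induced endomorphism \<theta> of \<open>X\<close>\<close>

lemma ex_nontrivial: "\<exists>v\<in>carrier M. v \<noteq> \<one>\<^bsub>M\<^esub>"
proof -
  obtain c where c: "c \<in> carrier C" "c \<noteq> \<one>\<^bsub>C\<^esub>"
    using nontrivial C.one_closed by blast
  have "single C X \<one>\<^bsub>X\<^esub> c \<one>\<^bsub>X\<^esub> = c"
    by (simp add: single_def)
  then have "single C X \<one>\<^bsub>X\<^esub> c \<noteq> \<one>\<^bsub>M\<^esub>"
    using c(2) by (metis M_one_val X.one_closed)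
  with single_closed[OF c(1)] show ?thesis by blast
qed

lemma diff_ne_one:
  assumes "v \<in> carrier M" "v \<noteq> \<one>\<^bsub>M\<^esub>" "x \<in> carrier X" "x \<noteq> \<one>\<^bsub>X\<^esub>"
  shows "diff x v \<noteq> \<one>\<^bsub>M\<^esub>"
  using diff_eq_one[OF assms(1,3) inj_pow[OF assms(3,4)]] assms(2) by blast

lemma pow_m_ne_one: "x \<in> carrier X \<Longrightarrow> x \<noteq> \<one>\<^bsub>X\<^esub> \<Longrightarrow> x [^]\<^bsub>X\<^esub> m \<noteq> \<one>\<^bsub>X\<^esub>"
  using torsion_free m_pos by blast

text \<open>By semilinearity \<open>f ((x - 1) v) = (\<theta> x - 1) f v\<close>, which is trivial
  when \<theta> sends \<open>x\<close> to the identity.\<close>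

lemma not_simple_if_kernel:
  assumes h: "h \<in> H" "snd h \<noteq> \<one>\<^bsub>X\<^esub>" "snd (f h) = \<one>\<^bsub>X\<^esub>"
  shows "\<not> simple_virtual_endomorphism W H f"
proof (rule W.not_simple_virtual_endomorphism)
  have x: "snd h \<in> carrier X"
    using h(1) by (intro snd.hom_closed H.mem_carrier)
  let ?Y = "{base (diff (snd h) v) | v. v \<in> carrier M \<and> base v \<in> H}"
  show "?Y \<subseteq> H"
    using x by (blast intro: base_diff_H)
  show "f ` ?Y \<subseteq> generate W ?Y"
  proof (rule image_subsetI)
    fix y assume "y \<in> ?Y"
    then obtain v where v: "v \<in> carrier M" "base v \<in> H" and y: "y = base (diff (snd h) v)"
      by blast
    obtain u where u: "u \<in> carrier M" "f (base v) = base u"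
      using f_base[OF v] by blast
    have "f y = \<one>\<^bsub>W\<^esub>"
      by (simp only: y f_base_diff[OF v h(1) u] h(3) diff_one u(1) one_W)
    then show "f y \<in> generate W ?Y"
      by (simp only: generate.one)
  qed
  show "\<not> ?Y \<subseteq> {\<one>\<^bsub>W\<^esub>}"
  proof -
    obtain v where v: "v \<in> carrier M" "v \<noteq> \<one>\<^bsub>M\<^esub>"
      using ex_nontrivial by blast
    \<comment> \<open>Multiplication by \<open>x^m - 1\<close> moves \<open>v\<close> into
      \<open>H\<close>, and neither this factor nor \<open>x - 1\<close> annihilates a nontrivial
      element.\<close>
    let ?v = "diff (snd h [^]\<^bsub>X\<^esub> m) v"
    have "?v \<in> carrier M" "base ?v \<in> H"
      using v x by (auto intro: diff_closed base_diff_m_H)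
    moreover have "diff (snd h) ?v \<noteq> \<one>\<^bsub>M\<^esub>"
      using v x h(2) by (intro diff_ne_one diff_closed pow_m_ne_one X.nat_pow_closed)
    ultimately show ?thesis
      unfolding one_W by (auto simp only: base_eq_iff)
  qed
  show "g \<otimes>\<^bsub>W\<^esub> y \<otimes>\<^bsub>W\<^esub> inv\<^bsub>W\<^esub> g \<in> ?Y" if "y \<in> ?Y" "g \<in> carrier W" for y g
  proof -
    obtain v where v: "v \<in> carrier M" "base v \<in> H" "y = base (diff (snd h) v)"
      using \<open>y \<in> ?Y\<close> by blast
    have g: "snd g \<in> carrier X"
      using that(2) by (rule snd.hom_closed)
    have "g \<otimes>\<^bsub>W\<^esub> y \<otimes>\<^bsub>W\<^esub> inv\<^bsub>W\<^esub> g = base (diff (snd h) (shift (snd g) v))"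
      using v x g that(2) by (simp only: conj_base diff_closed shift_diff)
    then show ?thesis
      using v g by (blast intro: shift_closed base_shift_H)
  qed
qed

text \<open>The same \<open>m\<close> serves for \<open>x\<close> and for \<open>\<theta> x\<close>.
  Hence it suffices that \<open>f\<close> maps \<open>(x^m - 1) M\<close> into
  \<open>((\<theta> x)^m - 1) M\<close>, whose elements again belong to the generating set.\<close>

lemma not_simple_if_injective:
  assumes inj: "\<And>h. h \<in> H \<Longrightarrow> snd (f h) = \<one>\<^bsub>X\<^esub> \<Longrightarrow> snd h = \<one>\<^bsub>X\<^esub>"
    and X: "carrier X \<noteq> {\<one>\<^bsub>X\<^esub>}"
  shows "\<not> simple_virtual_endomorphism W H f"
proof (rule W.not_simple_virtual_endomorphism)
  let ?Y = "{base (diff (x [^]\<^bsub>X\<^esub> m) v) | x v. x \<in> carrier X \<and> v \<in> carrier M}"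
  show "?Y \<subseteq> H"
  proof
    fix y assume "y \<in> ?Y"
    then obtain x v where "x \<in> carrier X" "v \<in> carrier M" "y = base (diff (x [^]\<^bsub>X\<^esub> m) v)"
      by blast
    then show "y \<in> H"
      by (simp only: base_diff_m_H)
  qed
  show "f ` ?Y \<subseteq> generate W ?Y"
  proof (rule image_subsetI)
    fix y assume "y \<in> ?Y"
    then obtain x v where x: "x \<in> carrier X" and v: "v \<in> carrier M"
      and y: "y = base (diff (x [^]\<^bsub>X\<^esub> m) v)"
      by blast
    show "f y \<in> generate W ?Y"
    \<comment> \<open>The identity has no independent partner, but its generators are
      trivial.\<close>
    proof (cases "x = \<one>\<^bsub>X\<^esub>")
      case True
      then have "f y = \<one>\<^bsub>W\<^esub>"
        using v by (simp only: y X.nat_pow_one diff_one f_one flip: one_W)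
      then show ?thesis by (simp only: generate.one)
    next
      case False
      then obtain x' where x': "x' \<in> carrier X" and indep: "independent_powers X x x'"
        using ex_independent[OF x] by blast
      obtain h h' where h: "h \<in> H" "snd h = x" and h': "h' \<in> H" "snd h' = x'"
        using onto x x' by meson
      define z where "z = snd (f h) [^]\<^bsub>X\<^esub> m"
      define z' where "z' = snd (f h') [^]\<^bsub>X\<^esub> m"
      have fh: "snd (f h) \<in> carrier X" and fh': "snd (f h') \<in> carrier X"
        using h(1) h'(1) by (auto intro!: snd.hom_closed f_closed)
      then have z: "z \<in> carrier X" and z': "z' \<in> carrier X"
        by (auto simp: z_def z'_def)
      have snd_pow: "snd (g [^]\<^bsub>W\<^esub> k) = snd g [^]\<^bsub>X\<^esub> k" if "g \<in> carrier W" for g and k :: nat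
        using that by (rule snd.hom_nat_pow)
      have z_h: "snd (f (h [^]\<^bsub>W\<^esub> m)) = z" "snd (f (h' [^]\<^bsub>W\<^esub> m)) = z'"
        using h(1) h'(1) by (simp_all only: f_pow snd_pow f_closed z_def z'_def)
      have x_h: "snd (h [^]\<^bsub>W\<^esub> m) = x [^]\<^bsub>X\<^esub> m" "snd (h' [^]\<^bsub>W\<^esub> m) = x' [^]\<^bsub>X\<^esub> m"
        using h h' by (simp_all only: snd_pow H.mem_carrier)
      \<comment> \<open>A relation between \<open>z\<close> and \<open>z'\<close> is the image of
        one between powers of \<open>h\<close> and \<open>h'\<close>. Injectivity of \<theta>
        carries it back to \<open>x\<close> and \<open>x'\<close>, with all exponents multiplied by
        \<open>m\<close>.\<close>
      have indep_z: "independent_powers X z z'"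
        unfolding independent_powers_def
      proof (intro allI impI)
        fix k j k' j' :: nat
        assume eq: "z [^]\<^bsub>X\<^esub> k \<otimes>\<^bsub>X\<^esub> z' [^]\<^bsub>X\<^esub> j = z [^]\<^bsub>X\<^esub> k' \<otimes>\<^bsub>X\<^esub> z' [^]\<^bsub>X\<^esub> j'"
        let ?g = "\<lambda>k j :: nat. h [^]\<^bsub>W\<^esub> (m * k) \<otimes>\<^bsub>W\<^esub> h' [^]\<^bsub>W\<^esub> (m * j)"
        have g: "?g k j \<in> H" for k j
          using h(1) h'(1) by (intro H.m_closed pow_H)
        have fg: "snd (f (?g k j)) = z [^]\<^bsub>X\<^esub> k \<otimes>\<^bsub>X\<^esub> z' [^]\<^bsub>X\<^esub> j" for k j
          using h(1) h'(1) fh fh'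
          by (simp only: f_mult pow_H f_pow snd.hom_mult snd_pow f_closed W.nat_pow_closed
              z_def z'_def X.nat_pow_pow)
        have sg: "snd (?g k j) = x [^]\<^bsub>X\<^esub> (m * k) \<otimes>\<^bsub>X\<^esub> x' [^]\<^bsub>X\<^esub> (m * j)" for k j
          using h h' by (simp only: snd.hom_mult snd_pow H.mem_carrier W.nat_pow_closed)
        have "snd (f (?g k j \<otimes>\<^bsub>W\<^esub> inv\<^bsub>W\<^esub> ?g k' j')) = \<one>\<^bsub>X\<^esub>"
          using g[of k j] g[of k' j'] fg[of k j] fg[of k' j'] eq z z'
          by (simp only: f_mult f_inv H.m_inv_closed snd.hom_mult snd.hom_inv f_closed W.inv_closed
              X.r_inv X.m_closed X.nat_pow_closed)
        then have "snd (?g k j \<otimes>\<^bsub>W\<^esub> inv\<^bsub>W\<^esub> ?g k' j') = \<one>\<^bsub>X\<^esub>"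
          by (rule inj[OF H.m_closed[OF g H.m_inv_closed[OF g]]])
        then have "snd (?g k j) \<otimes>\<^bsub>X\<^esub> inv\<^bsub>X\<^esub> snd (?g k' j') = \<one>\<^bsub>X\<^esub>"
          using H.mem_carrier[OF g] by (simp only: snd.hom_mult snd.hom_inv W.inv_closed)
        then have "snd (?g k j) = snd (?g k' j')"
          using snd.hom_closed[OF H.mem_carrier[OF g]] by (simp only: X.mult_inv_eq_one_iff)
        then have "m * k = m * k'" "m * j = m * j'"
          unfolding sg by (rule independent_powersD[OF indep])+
        then show "k = k' \<and> j = j'"
          using m_pos by simp
      qed
      let ?v = "diff (x [^]\<^bsub>X\<^esub> m) v" and ?v' = "diff (x' [^]\<^bsub>X\<^esub> m) v"
      have V: "?v \<in> carrier M" "base ?v \<in> H" "?v' \<in> carrier M" "base ?v' \<in> H"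
        using v x x' by (auto intro: diff_closed base_diff_m_H)
      obtain s where s: "s \<in> carrier M" "f (base ?v) = base s"
        using f_base[OF V(1,2)] by blast
      obtain t where t: "t \<in> carrier M" "f (base ?v') = base t"
        using f_base[OF V(3,4)] by blast
      \<comment> \<open>\<open>f\<close> is evaluated on one element written in two ways, with
        \<open>x'^m - 1\<close> or with \<open>x^m - 1\<close> as the outer factor.\<close>
      have "base (diff z' s) = f (base (diff (x' [^]\<^bsub>X\<^esub> m) ?v))"
        using f_base_diff[OF V(1,2) pow_H[OF h'(1)] s, of m] by (simp only: z_h x_h)
      also have "\<dots> = f (base (diff (x [^]\<^bsub>X\<^esub> m) ?v'))"
        using v x x' by (simp only: diff_diff X.nat_pow_closed)
      also have "\<dots> = base (diff z t)"
        using f_base_diff[OF V(3,4) pow_H[OF h(1)] t, of m] by (simp only: z_h x_h)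
      finally have "diff z' s = diff z t"
        by (simp only: base_eq_iff)
      then obtain r where r: "r \<in> carrier M" "s = diff z r"
        using diff_divides[OF indep_z z z' s(1) t(1)] by blast
      then have "f y \<in> ?Y"
        unfolding y s(2) z_def using fh by blast
      then show ?thesis by (rule generate.incl)
    qed
  qed
  show "\<not> ?Y \<subseteq> {\<one>\<^bsub>W\<^esub>}"
  proof -
    obtain x where x: "x \<in> carrier X" "x \<noteq> \<one>\<^bsub>X\<^esub>"
      using X X.one_closed by blast
    obtain v where v: "v \<in> carrier M" "v \<noteq> \<one>\<^bsub>M\<^esub>"
      using ex_nontrivial by blast
    have "diff (x [^]\<^bsub>X\<^esub> m) v \<noteq> \<one>\<^bsub>M\<^esub>"
      using v x by (intro diff_ne_one pow_m_ne_one X.nat_pow_closed)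
    then have "base (diff (x [^]\<^bsub>X\<^esub> m) v) \<noteq> \<one>\<^bsub>W\<^esub>"
      by (simp only: one_W base_eq_iff not_False_eq_True)
    moreover have "base (diff (x [^]\<^bsub>X\<^esub> m) v) \<in> ?Y"
      using v(1) x(1) by blast
    ultimately show ?thesis by blast
  qed
  show "g \<otimes>\<^bsub>W\<^esub> y \<otimes>\<^bsub>W\<^esub> inv\<^bsub>W\<^esub> g \<in> ?Y" if "y \<in> ?Y" "g \<in> carrier W" for y g
  proof -
    obtain x v where v: "x \<in> carrier X" "v \<in> carrier M" "y = base (diff (x [^]\<^bsub>X\<^esub> m) v)"
      using \<open>y \<in> ?Y\<close> by blast
    have g: "snd g \<in> carrier X"
      using that(2) by (rule snd.hom_closed)
    have "g \<otimes>\<^bsub>W\<^esub> y \<otimes>\<^bsub>W\<^esub> inv\<^bsub>W\<^esub> g = base (diff (x [^]\<^bsub>X\<^esub> m) (shift (snd g) v))"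
      using v g that(2) by (simp only: conj_base diff_closed shift_diff X.nat_pow_closed)
    then show ?thesis
      using v g by (blast intro: shift_closed)
  qed
qed

theorem not_simple:
  assumes "carrier X \<noteq> {\<one>\<^bsub>X\<^esub>}"
  shows "\<not> simple_virtual_endomorphism W H f"
  using not_simple_if_kernel not_simple_if_injective assms by blast

end

section \<open>Free abelian groups\<close>

lemma (in group_hom) independent_powers_preimage:
  assumes "x \<in> carrier G" "y \<in> carrier G" "independent_powers H (h x) (h y)"
  shows "independent_powers G x y"
  unfolding independent_powers_def
proof (intro allI impI)
  fix k j k' j' :: nat
  assume eq: "x [^] k \<otimes> y [^] j = x [^] k' \<otimes> y [^] j'"
  have "h (x [^] k \<otimes> y [^] j) = h x [^]\<^bsub>H\<^esub> k \<otimes>\<^bsub>H\<^esub> h y [^]\<^bsub>H\<^esub> j" for k j :: nat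
    using assms by (simp add: hom_nat_pow)
  then have "h x [^]\<^bsub>H\<^esub> k \<otimes>\<^bsub>H\<^esub> h y [^]\<^bsub>H\<^esub> j = h x [^]\<^bsub>H\<^esub> k' \<otimes>\<^bsub>H\<^esub> h y [^]\<^bsub>H\<^esub> j'"
    using eq by metis
  then show "k = k' \<and> j = j'"
    using independent_powersD[OF assms(3)] by blast
qed

text \<open>The witness is a basis element \<open>l\<close> other than some \<open>i\<close> in the
  support of \<open>x\<close>. The coordinate at \<open>i\<close> determines the exponent of
  \<open>x\<close>, and then the coordinate at \<open>l\<close> determines the other.\<close>

lemma free_Abelian_group_ex_independent_powers:
  assumes x: "x \<in> carrier (free_Abelian_group S)" "x \<noteq> \<one>\<^bsub>free_Abelian_group S\<^esub>"
    and S: "\<And>i. \<exists>l\<in>S. l \<noteq> i"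
  shows "\<exists>y\<in>carrier (free_Abelian_group S). independent_powers (free_Abelian_group S) x y"
proof -
  obtain i where i: "Poly_Mapping.lookup x i \<noteq> 0"
    using x(2) by (auto simp: poly_mapping_eq_iff fun_eq_iff)
  obtain l where l: "l \<in> S" "l \<noteq> i"
    using S by blast
  have "independent_powers (free_Abelian_group S) x (frag_of l)"
    unfolding independent_powers_def pow_free_Abelian_group mult_free_Abelian_group
  proof (intro allI impI)
    fix k j k' j' :: nat
    assume eq: "frag_cmul (int k) x + frag_cmul (int j) (frag_of l)
      = frag_cmul (int k') x + frag_cmul (int j') (frag_of l)"
    have coord: "int k * Poly_Mapping.lookup x n + int j * Poly_Mapping.lookup (frag_of l) n
        = int k' * Poly_Mapping.lookup x n + int j' * Poly_Mapping.lookup (frag_of l) n" for n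
      using arg_cong[OF eq, of "\<lambda>u. Poly_Mapping.lookup u n"] by (simp add: lookup_add)
    have "k = k'"
      using coord[of i] i l(2) by (simp add: lookup_single)
    moreover from this have "j = j'"
      using coord[of l] by simp
    ultimately show "k = k' \<and> j = j'" by blast
  qed
  with l(1) show ?thesis
    by (intro bexI[of _ "frag_of l"]) auto
qed

theorem theorem1:
  fixes p d :: nat
    and C :: "('c, 'm) monoid_scheme"
    and c :: 'c
    and X :: "('x, 'n) monoid_scheme"
    and G :: "(('x \<Rightarrow> 'c) \<times> 'x) monoid"
    and A H :: "(('x \<Rightarrow> 'c) \<times> 'x) set"
    and a :: "('x \<Rightarrow> 'c) \<times> 'x"
    and f :: "('x \<Rightarrow> 'c) \<times> 'x \<Rightarrow> ('x \<Rightarrow> 'c) \<times> 'x"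
  assumes "prime p"
    and "d \<ge> 2"
    and "group C" and "order C = p"
    and "c \<in> carrier C" and "generate C {c} = carrier C"
    and "group X" and "X \<cong> free_Abelian_group {..<d}"
    and "G = restricted_wreath C X"
    and "a = wreath_base C X c"
    and "A = normal_closure G (generate G {a})"
    and "virtual_endomorphism G H f"
    and "A <#>\<^bsub>G\<^esub> H = carrier G"
  shows "\<not> simple_virtual_endomorphism G H f"
proof -
  interpret C: group C by fact
  interpret X: group X by fact
  let ?F = "free_Abelian_group {..<d}"
  have "cyclic_group C"
    using assms(5,6) unfolding cyclic_group_def subgroup_generated_def
    by (intro bexI[of _ c]) simp_all
  then have comm_C: "comm_group C"
    by (rule C.cyclic_imp_abelian_group)
  have comm_X: "comm_group X"
    using abelian_free_Abelian_group X.iso_sym[OF assms(8)] X.is_monoid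
    by (rule comm_group.iso_imp_comm_group)
  interpret abelian_wreath C X
    using comm_C comm_X by (simp add: abelian_wreath_def)
  obtain \<phi> where \<phi>: "\<phi> \<in> iso X ?F"
    using assms(8) by (auto simp: is_iso_def)
  then have bij: "bij_betw \<phi> (carrier X) (carrier ?F)"
    by (simp add: iso_def)
  interpret \<phi>: group_hom X ?F \<phi>
    using \<phi> X.is_group by (simp add: group_hom_def group_hom_axioms_def iso_def)
  \<comment> \<open>Rank at least 2 enters here: every index can be avoided by 0 or 1.\<close>
  have two: "\<exists>l\<in>{..<d}. l \<noteq> i" for i
    using assms(2) by (intro bexI[of _ "if i = 0 then 1 else 0"]) auto
  interpret wreath_virtual_endomorphism C X H f p
  proof unfold_locales
    show "virtual_endomorphism W H f"
      using assms(9,12) by simp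
  next
    fix x assume x: "x \<in> carrier X"
    \<comment> \<open>The kernel of the projection is normal and contains \<open>a\<close>, hence
      contains \<open>A\<close>. Writing \<open>(1, x)\<close> as \<open>b h\<close> with
      \<open>b\<close> in \<open>A\<close> therefore gives \<open>h\<close> the second coordinate
      \<open>x\<close>.\<close>
    let ?N = "kernel W X snd"
    have "a \<in> ?N"
      using single_closed[OF assms(5)] by (simp add: assms(10) wreath_base_def kernel_def carrier_W)
    then have "generate W {a} \<subseteq> ?N"
      by (intro W.generate_subgroup_incl snd.subgroup_kernel) simp
    then have A: "A \<subseteq> ?N"
      unfolding assms(9,11) normal_closure_def using snd.normal_kernel by blast
    have "(\<one>\<^bsub>M\<^esub>, x) \<in> carrier W"
      using x M.one_closed by (simp only: carrier_W mem_Times_iff fst_conv snd_conv)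
    then obtain b h where bh: "b \<in> A" "h \<in> H" "(\<one>\<^bsub>M\<^esub>, x) = b \<otimes>\<^bsub>W\<^esub> h"
      using assms(13) unfolding assms(9) set_mult_def by blast
    have hW: "h \<in> carrier W"
      using bh(2) assms(9,12) by (auto simp: virtual_endomorphism_def dest: subgroup.mem_carrier)
    have b: "b \<in> carrier W" "snd b = \<one>\<^bsub>X\<^esub>"
      using bh(1) A by (auto simp: kernel_def)
    have "x = snd b \<otimes>\<^bsub>X\<^esub> snd h"
      using arg_cong[OF bh(3), of snd] snd.hom_mult[OF b(1) hW] by simp
    then show "\<exists>h\<in>H. snd h = x"
      using bh(2) b(2) snd.hom_closed[OF hW] by auto
  next
    fix x assume x: "x \<in> carrier X" "x \<noteq> \<one>\<^bsub>X\<^esub>"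
    have "\<phi> x \<noteq> \<one>\<^bsub>?F\<^esub>"
      using x bij \<phi>.hom_one by (metis X.one_closed bij_betw_inv_into_left)
    then obtain y where y: "y \<in> carrier ?F" "independent_powers ?F (\<phi> x) y"
      using free_Abelian_group_ex_independent_powers[OF \<phi>.hom_closed[OF x(1)] _ two] by blast
    then obtain y' where "y' \<in> carrier X" "y = \<phi> y'"
      using bij by (metis bij_betw_imp_surj_on imageE)
    then show "\<exists>y\<in>carrier X. independent_powers X x y"
      using \<phi>.independent_powers_preimage[OF x(1)] y(2) by blast
  next
    show "p > 0"
      using assms(1) by (rule prime_gt_0_nat)
    show "z [^]\<^bsub>C\<^esub> p = \<one>\<^bsub>C\<^esub>" if "z \<in> carrier C" for z
      using C.pow_order_eq_1[OF that] assms(4) by simp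
    show "carrier C \<noteq> {\<one>\<^bsub>C\<^esub>}"
      using assms(1,4) by (auto simp: order_def)
  qed
  have "carrier X \<noteq> {\<one>\<^bsub>X\<^esub>}"
  proof
    assume "carrier X = {\<one>\<^bsub>X\<^esub>}"
    then have "carrier ?F = {\<one>\<^bsub>?F\<^esub>}"
      using bij \<phi>.hom_one by (auto dest!: bij_betw_imp_surj_on)
    moreover have "frag_of 0 \<in> carrier ?F"
      using assms(2) by simp
    ultimately show False by (simp del: carrier_free_Abelian_group_iff)
  qed
  then show ?thesis
    unfolding assms(9) by (rule not_simple)
qed

end
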